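(* A real Banach space $B$ with dual $B^*$ is reflexive if and only if, for every nonempty, closed, and convex $C\subset B$, $\pi_C(\phi)\neq\emptyset$ for every $\phi\in B^*$.
   Context: $\langle\cdot,\cdot\rangle$ is the pairing between $B^*$ and $B$. $V(\phi,x)=\|\phi\|^2-2\langle\phi,x\rangle+\|x\|^2$ for $\phi\in B^*$, $x\in B$. The generalized projection is $\pi_C(\phi)=\{u\in C: V(\phi,u)=\inf_{y\in C}V(\phi,y)\}$ for $\phi\in B^*$ (possibly empty). *)

theory Defs
  imports "HOL-Analysis.Analysis"
begin

type_synonym 'a dual = "'a \<Rightarrow>\<^sub>L real"

lift_definition canonical_embedding :: "'a::real_normed_vector \<Rightarrow> 'a dual dual"
  is "\<lambda>x \<phi>. blinfun_apply \<phi> x"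
  by (rule blinfun.bounded_linear_left)

text \<open>The argument is a type token: \<open>reflexive_space TYPE('a)\<close> says that the space \<open>'a\<close>
  is reflexive.\<close>

definition reflexive_space :: "'a::banach itself \<Rightarrow> bool" where
  "reflexive_space _ \<longleftrightarrow> surj (canonical_embedding :: 'a \<Rightarrow> 'a dual dual)"

definition V :: "'a::real_normed_vector dual \<Rightarrow> 'a \<Rightarrow> real" where
  "V \<phi> x = (norm \<phi>)\<^sup>2 - 2 * blinfun_apply \<phi> x + (norm x)\<^sup>2"

text \<open>The infimum is a genuine one whenever \<open>C\<close> is nonempty, since
  \<open>V \<phi> y \<ge> (norm \<phi> - norm y)\<^sup>2 \<ge> 0\<close>.\<close>

definition generalized_projection ::
  "'a::real_normed_vector set \<Rightarrow> 'a dual \<Rightarrow> 'a set" where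
  "generalized_projection C \<phi> = {u \<in> C. V \<phi> u = (INF y\<in>C. V \<phi> y)}"

end

theory Submission
  imports Defs
begin

text \<open>In a reflexive space, sublevel sets of \<open>V \<phi>\<close> in \<open>C\<close> are bounded, closed, and convex, and a
  decreasing sequence of such sets has a common point: a linear functional on the dual dominated by
  \<open>limsup f(x\<^sub>n)\<close> along points \<open>x\<^sub>n\<close> of the sets is evaluation at some \<open>u\<close>, and \<open>u\<close> lies in every set
  by separation.

  Conversely, for a nonreflexive space, Helly's theorem yields bounded sequences with
  \<open>f\<^sub>n(x\<^sub>k) = d > 0\<close> for \<open>n \<le> k\<close> and \<open>f\<^sub>n(x\<^sub>k) = 0\<close> for \<open>k < n\<close>. On \<open>Y = closure (span {x\<^sub>k})\<close> the \<open>f\<^sub>n\<close> tend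
  pointwise to \<open>0\<close>, while their convex combinations stay bounded away from \<open>0\<close> in norm. This is the
  situation of the separable case of James's theorem, and a dyadic series of near-minimal convex
  combinations gives a functional \<open>g\<close> that does not attain its norm on \<open>Y\<close>. Closed convex subsets
  of \<open>Y\<close> are closed and convex in the whole space, so \<open>{y \<in> Y. 1 \<le> g y}\<close>, which has no element of
  minimal norm, has empty generalized projection of \<open>0\<close>; no nonseparable version of James's theorem
  is required.\<close>

subsection \<open>Sublinear functionals and separation\<close>

text \<open>Homogeneity is demanded only as an inequality for positive scalars, so each new
  functional needs a single estimate; scaling back by \<open>1 / c\<close> restores equality, and
  the value 0 at 0 follows.\<close>

definition sublinear :: "('a::real_vector \<Rightarrow> real) \<Rightarrow> bool" where
  "sublinear p \<longleftrightarrow> (\<forall>x y. p (x + y) \<le> p x + p y) \<and> (\<forall>c>0. \<forall>x. p (c *\<^sub>R x) \<le> c * p x)"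

lemma sublinear_add: "sublinear p \<Longrightarrow> p (x + y) \<le> p x + p y"
  by (simp add: sublinear_def)

lemma sublinear_scaleR:
  assumes "sublinear p" "c > 0"
  shows "p (c *\<^sub>R x) = c * p x"
proof (rule antisym)
  have "p ((1 / c) *\<^sub>R (c *\<^sub>R x)) \<le> (1 / c) * p (c *\<^sub>R x)"
    using assms unfolding sublinear_def by (meson zero_less_divide_1_iff)
  then show "c * p x \<le> p (c *\<^sub>R x)"
    using assms(2) by (simp add: field_simps)
qed (use assms in \<open>simp add: sublinear_def\<close>)

lemma sublinear_0: "sublinear p \<Longrightarrow> p 0 = 0"
  using sublinear_scaleR[of p 2 0] by simp

lemma sublinear_minus: "sublinear p \<Longrightarrow> - p (- x) \<le> p x"
  using sublinear_add[of p x "- x"] sublinear_0[of p] by simp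

lemma sublinear_norm: "sublinear norm"
  by (simp add: sublinear_def norm_triangle_ineq)

text \<open>A pair \<open>(v, s)\<close> of the convex cone \<open>K\<close> is a demand
  \<open>s \<le> L v\<close> on a future linear \<open>L\<close>. The infimal convolution
  \<open>q\<close> lowers \<open>p\<close> so that every linear functional below \<open>q\<close>
  meets all demands at once.\<close>

lemma sublinear_constrain:
  fixes p :: "'a::real_vector \<Rightarrow> real"
  assumes p: "sublinear p"
    and K0: "(0, 0) \<in> K"
    and Kadd: "\<And>v s w t. (v, s) \<in> K \<Longrightarrow> (w, t) \<in> K \<Longrightarrow> (v + w, s + t) \<in> K"
    and Kscale: "\<And>v s c. (v, s) \<in> K \<Longrightarrow> c > 0 \<Longrightarrow> (c *\<^sub>R v, c * s) \<in> K"
    and le: "\<And>v s. (v, s) \<in> K \<Longrightarrow> s \<le> p v"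
  obtains q where "sublinear q" "\<And>x. q x \<le> p x" "\<And>v s. (v, s) \<in> K \<Longrightarrow> q (- v) \<le> - s"
proof -
  define q where "q = (\<lambda>x. INF (v, s)\<in>K. p (x + v) - s)"
  \<comment> \<open>Feasibility of the demands, \<open>s \<le> p v\<close>, keeps the infimum
    finite.\<close>
  have bdd: "bdd_below ((\<lambda>(v, s). p (x + v) - s) ` K)" for x
  proof (rule bdd_belowI2[where m = "- p (- x)"], clarify)
    fix v s assume "(v, s) \<in> K"
    then show "- p (- x) \<le> p (x + v) - s"
      using le[of v s] sublinear_add[OF p, of "x + v" "- x"] by (simp add: algebra_simps)
  qed
  have upper: "q x \<le> p (x + v) - s" if "(v, s) \<in> K" for x v s
    unfolding q_def using cINF_lower[OF bdd that, of x] by simp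
  have lower: "m \<le> q x" if "\<And>v s. (v, s) \<in> K \<Longrightarrow> m \<le> p (x + v) - s" for m x
    unfolding q_def using K0 that by (intro cINF_greatest) auto
  have "sublinear q"
    unfolding sublinear_def
  proof (intro conjI allI impI)
    fix x y
    have "q (x + y) - (p (y + w) - t) \<le> q x" if "(w, t) \<in> K" for w t
    proof (rule lower)
      fix v s assume "(v, s) \<in> K"
      then have "q (x + y) \<le> p ((x + y) + (v + w)) - (s + t)"
        using that by (intro upper Kadd)
      also have "\<dots> \<le> p (x + v) + p (y + w) - (s + t)"
        using sublinear_add[OF p, of "x + v" "y + w"] by (simp add: algebra_simps)
      finally show "q (x + y) - (p (y + w) - t) \<le> p (x + v) - s"
        by simp
    qed
    then have "q (x + y) - q x \<le> q y"
      by (intro lower) (simp add: algebra_simps)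
    then show "q (x + y) \<le> q x + q y"
      by simp
  next
    fix c :: real and x assume c: "c > 0"
    have "q (c *\<^sub>R x) / c \<le> q x"
    proof (rule lower)
      fix v s assume "(v, s) \<in> K"
      then have "q (c *\<^sub>R x) \<le> p (c *\<^sub>R x + c *\<^sub>R v) - c * s"
        using c by (intro upper Kscale)
      also have "\<dots> = c * (p (x + v) - s)"
        using sublinear_scaleR[OF p c, of "x + v"] by (simp add: algebra_simps)
      finally show "q (c *\<^sub>R x) / c \<le> p (x + v) - s"
        using c by (simp add: field_simps)
    qed
    then show "q (c *\<^sub>R x) \<le> c * q x"
      using c by (simp add: field_simps)
  qed
  moreover have "q x \<le> p x" for x
    using upper[OF K0, of x] by simp
  moreover have "q (- v) \<le> - s" if "(v, s) \<in> K" for v s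
    using upper[OF that, of "- v"] sublinear_0[OF p] by simp
  ultimately show ?thesis
    using that by blast
qed

text \<open>Zorn's lemma for the reversed pointwise order. The infimum of a chain stays finite
  because every sublinear \<open>b \<le> p\<close> satisfies
  \<open>- p (- x) \<le> b x\<close>.\<close>

lemma minimal_sublinear_exists:
  fixes p :: "'a::real_vector \<Rightarrow> real"
  assumes p: "sublinear p"
  obtains q where "sublinear q" "q \<le> p" "\<And>r. sublinear r \<Longrightarrow> r \<le> q \<Longrightarrow> r = q"
proof -
  define A where "A = {q. sublinear q \<and> q \<le> p}"
  have "\<exists>m\<in>A. \<forall>a\<in>A. a \<le> m \<longrightarrow> a = m"
  proof (rule predicate_Zorn)
    show "partial_order_on A (relation_of (\<lambda>a b. b \<le> a) A)"
      by (auto simp: partial_order_on_def preorder_on_def refl_on_def trans_def antisym_def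
          relation_of_def)
    fix C assume C: "C \<in> Chains (relation_of (\<lambda>a b. b \<le> a) A)"
    then have CA: "a \<in> A" if "a \<in> C" for a
      using that by (auto simp: Chains_def relation_of_def)
    have total: "a \<le> b \<or> b \<le> a" if "a \<in> C" "b \<in> C" for a b
      using C that by (auto simp: Chains_def relation_of_def)
    show "\<exists>u\<in>A. \<forall>a\<in>C. u \<le> a"
    proof (cases "C = {}")
      case True
      then show ?thesis
        using p by (auto simp: A_def)
    next
      case False
      define u where "u = (\<lambda>x. INF a\<in>C. a x)"
      have upper: "u x \<le> a x" if "a \<in> C" for a x
        unfolding u_def
      proof (rule cINF_lower[OF _ that], rule bdd_belowI2[where m = "- p (- x)"])
        fix b assume "b \<in> C"
        then have "sublinear b" "b (- x) \<le> p (- x)"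
          using CA by (auto simp: A_def le_fun_def)
        then show "- p (- x) \<le> b x"
          using sublinear_minus[of b x] by linarith
      qed
      have lower: "m \<le> u x" if "\<And>a. a \<in> C \<Longrightarrow> m \<le> a x" for m x
        unfolding u_def using False that by (intro cINF_greatest) auto
      have "sublinear u"
        unfolding sublinear_def
      proof (intro conjI allI impI)
        fix x y
        \<comment> \<open>An infimum of sublinear functionals need not be subadditive; in a chain
          the smaller of \<open>a\<close> and \<open>b\<close> serves both arguments.\<close>
        have *: "u (x + y) \<le> a x + b y" if ab: "a \<in> C" "b \<in> C" for a b
        proof -
          obtain e where e: "e \<in> C" "e \<le> a" "e \<le> b"
            using total[OF ab] ab by blast
          have "u (x + y) \<le> e (x + y)"
            by (rule upper[OF e(1)])
          also have "\<dots> \<le> e x + e y"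
            using CA[OF e(1)] by (simp add: A_def sublinear_add)
          also have "\<dots> \<le> a x + b y"
            using e by (simp add: le_fun_def add_mono)
          finally show ?thesis .
        qed
        have "u (x + y) - b y \<le> u x" if "b \<in> C" for b
          using *[OF _ that] by (intro lower) (simp add: algebra_simps)
        then have "u (x + y) - u x \<le> u y"
          by (intro lower) (simp add: algebra_simps)
        then show "u (x + y) \<le> u x + u y"
          by simp
      next
        fix c :: real and x assume c: "c > 0"
        have "u (c *\<^sub>R x) / c \<le> u x"
        proof (rule lower)
          fix a assume a: "a \<in> C"
          have "a (c *\<^sub>R x) = c * a x"
            using CA[OF a] c by (simp add: A_def sublinear_scaleR)
          then show "u (c *\<^sub>R x) / c \<le> a x"
            using upper[OF a, of "c *\<^sub>R x"] c by (simp add: field_simps)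
        qed
        then show "u (c *\<^sub>R x) \<le> c * u x"
          using c by (simp add: field_simps)
      qed
      moreover have "u \<le> p"
      proof (rule le_funI)
        fix x
        obtain a where a: "a \<in> C"
          using False by blast
        then have "a x \<le> p x"
          using CA by (simp add: A_def le_fun_def)
        then show "u x \<le> p x"
          using upper[OF a, of x] by linarith
      qed
      ultimately show ?thesis
        using upper by (auto simp: A_def le_fun_def)
    qed
  qed
  then obtain q where "q \<in> A" "\<And>a. a \<in> A \<Longrightarrow> a \<le> q \<Longrightarrow> a = q"
    by blast
  then show ?thesis
    using that[of q] unfolding A_def by (auto dest: order_trans)
qed

text \<open>Demanding the value \<open>q y\<close> along the ray through \<open>y\<close> produces a
  sublinear \<open>r \<le> q\<close>, which minimality identifies with \<open>q\<close>; hence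
  \<open>q (- y) \<le> - q y\<close>. An odd sublinear functional is linear.\<close>

lemma minimal_sublinear_linear:
  fixes q :: "'a::real_vector \<Rightarrow> real"
  assumes q: "sublinear q" and minimal: "\<And>r. sublinear r \<Longrightarrow> r \<le> q \<Longrightarrow> r = q"
  shows "linear q"
proof -
  have odd: "q (- y) = - q y" for y
  proof -
    obtain r where r: "sublinear r" "\<And>x. r x \<le> q x"
      "\<And>v s. (v, s) \<in> {(t *\<^sub>R y, t * q y) |t. t \<ge> 0} \<Longrightarrow> r (- v) \<le> - s"
    proof (rule sublinear_constrain[OF q, of "{(t *\<^sub>R y, t * q y) |t. t \<ge> 0}"])
      fix v s w t
      assume "(v, s) \<in> {(t *\<^sub>R y, t * q y) |t. t \<ge> 0}" "(w, t) \<in> {(t *\<^sub>R y, t * q y) |t. t \<ge> 0}"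
      then obtain a b where "a \<ge> 0" "b \<ge> 0" "v = a *\<^sub>R y" "s = a * q y" "w = b *\<^sub>R y" "t = b * q y"
        by auto
      then show "(v + w, s + t) \<in> {(t *\<^sub>R y, t * q y) |t. t \<ge> 0}"
        by (intro CollectI exI[of _ "a + b"]) (auto simp: algebra_simps)
    next
      fix v s and c :: real
      assume "(v, s) \<in> {(t *\<^sub>R y, t * q y) |t. t \<ge> 0}" "c > 0"
      then obtain a where "a \<ge> 0" "v = a *\<^sub>R y" "s = a * q y"
        by auto
      then show "(c *\<^sub>R v, c * s) \<in> {(t *\<^sub>R y, t * q y) |t. t \<ge> 0}"
        using \<open>c > 0\<close> by (intro CollectI exI[of _ "c * a"]) auto
    next
      fix v s
      assume "(v, s) \<in> {(t *\<^sub>R y, t * q y) |t. t \<ge> 0}"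
      then obtain a where "a \<ge> 0" "v = a *\<^sub>R y" "s = a * q y"
        by auto
      then show "s \<le> q v"
        using sublinear_scaleR[OF q, of a y] sublinear_0[OF q] by (cases "a = 0") auto
    qed auto
    have "r = q"
      using r by (intro minimal) (auto simp: le_fun_def)
    moreover have "(y, q y) \<in> {(t *\<^sub>R y, t * q y) |t. t \<ge> 0}"
      by (intro CollectI exI[of _ 1]) auto
    ultimately show ?thesis
      using r(3)[of y "q y"] sublinear_minus[OF q, of y] by simp
  qed
  show ?thesis
  proof (rule linearI)
    fix x y
    have "q (- x + - y) \<le> q (- x) + q (- y)"
      by (rule sublinear_add[OF q])
    then show "q (x + y) = q x + q y"
      using odd[of "x + y"] odd[of x] odd[of y] sublinear_add[OF q, of x y] by simp
  next
    fix c :: real and x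
    consider "c > 0" | "c = 0" | "- c > 0"
      by linarith
    then show "q (c *\<^sub>R x) = c *\<^sub>R q x"
    proof cases
      case 3
      then show ?thesis
        using sublinear_scaleR[OF q 3, of x] odd[of "c *\<^sub>R x"] by simp
    qed (use sublinear_scaleR[OF q] sublinear_0[OF q] in auto)
  qed
qed

lemma Hahn_Banach_dominated:
  fixes p :: "'a::real_vector \<Rightarrow> real"
  assumes "sublinear p"
  obtains L where "linear L" "\<And>x. L x \<le> p x"
  using minimal_sublinear_exists[OF assms] minimal_sublinear_linear
  by (metis le_fun_def)

text \<open>The demands form the cone generated by \<open>C\<close> at height \<open>m\<close>;
  convexity of \<open>C\<close> makes it closed under addition. Any linear functional below the
  constrained \<open>q\<close> is at least \<open>m\<close> on \<open>C\<close>.\<close>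

lemma Mazur_Orlicz:
  fixes p :: "'a::real_vector \<Rightarrow> real"
  assumes p: "sublinear p" and C: "convex C" and le: "\<And>c. c \<in> C \<Longrightarrow> m \<le> p c"
  obtains L where "linear L" "\<And>x. L x \<le> p x" "\<And>c. c \<in> C \<Longrightarrow> m \<le> L c"
proof (cases "C = {}")
  case True
  then show ?thesis
    using Hahn_Banach_dominated[OF p] that by blast
next
  case False
  define K where "K = {(t *\<^sub>R c, t * m) |t c. t \<ge> 0 \<and> c \<in> C}"
  have K0: "(0, 0) \<in> K"
    using False unfolding K_def by force
  obtain q where q: "sublinear q" "\<And>x. q x \<le> p x" "\<And>v s. (v, s) \<in> K \<Longrightarrow> q (- v) \<le> - s"
  proof (rule sublinear_constrain[OF p K0])
    fix v s w t
    assume "(v, s) \<in> K" "(w, t) \<in> K"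
    then obtain a b c d where *: "a \<ge> 0" "b \<ge> 0" "c \<in> C" "d \<in> C"
      "v = a *\<^sub>R c" "s = a * m" "w = b *\<^sub>R d" "t = b * m"
      unfolding K_def by auto
    show "(v + w, s + t) \<in> K"
    proof (cases "a + b = 0")
      case True
      then have "a = 0" "b = 0"
        using * by auto
      then show ?thesis
        using * K0 by simp
    next
      case False
      then have pos: "a + b > 0"
        using * by linarith
      define e where "e = (a / (a + b)) *\<^sub>R c + (b / (a + b)) *\<^sub>R d"
      have "e \<in> C"
        unfolding e_def using * pos
        by (intro convexD[OF C]) (auto simp: add_divide_distrib[symmetric])
      moreover have "v + w = (a + b) *\<^sub>R e"
        using * pos by (simp add: e_def scaleR_add_right)
      moreover have "s + t = (a + b) * m"
        using * by (simp add: distrib_right)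
      ultimately show ?thesis
        unfolding K_def using pos by (intro CollectI exI[of _ "a + b"] exI[of _ e]) auto
    qed
  next
    fix v s and c :: real
    assume "(v, s) \<in> K" "c > 0"
    then obtain a d where "a \<ge> 0" "d \<in> C" "v = a *\<^sub>R d" "s = a * m"
      unfolding K_def by auto
    then show "(c *\<^sub>R v, c * s) \<in> K"
      using \<open>c > 0\<close> unfolding K_def by (intro CollectI exI[of _ "c * a"] exI[of _ d]) auto
  next
    fix v s
    assume "(v, s) \<in> K"
    then obtain a d where "a \<ge> 0" "d \<in> C" "v = a *\<^sub>R d" "s = a * m"
      unfolding K_def by auto
    then show "s \<le> p v"
      using sublinear_scaleR[OF p, of a d] sublinear_0[OF p] le[of d]
      by (cases "a = 0") (auto intro: mult_left_mono)
  qed auto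
  obtain L where L: "linear L" "\<And>x. L x \<le> q x"
    using Hahn_Banach_dominated[OF q(1)] by blast
  have "m \<le> L c" if "c \<in> C" for c
  proof -
    have "(c, m) \<in> K"
      unfolding K_def using that by (intro CollectI exI[of _ 1] exI[of _ c]) auto
    then have "L (- c) \<le> - m"
      using q(3) L(2) order_trans by blast
    then show ?thesis
      using linear_neg[OF L(1), of c] by simp
  qed
  then show ?thesis
    using that L q(2) order_trans by blast
qed

section \<open>Separation by bounded functionals\<close>

lemma linear_bounded_blinfun:
  fixes L :: "'a::real_normed_vector \<Rightarrow> real"
  assumes L: "linear L" and le: "\<And>x. L x \<le> M * norm x" and "M \<ge> 0"
  obtains G :: "'a dual" where "blinfun_apply G = L" "norm G \<le> M"
proof -
  have abs: "\<bar>L x\<bar> \<le> M * norm x" for x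
    using le[of x] le[of "- x"] linear_neg[OF L, of x] by (simp add: abs_le_iff)
  have "bounded_linear L"
    using L abs by (intro bounded_linear_intro[where K = M])
      (auto simp: linear_add linear_cmul mult.commute)
  then have "blinfun_apply (Blinfun L) = L"
    by (rule bounded_linear_Blinfun_apply)
  moreover from this have "norm (Blinfun L) \<le> M"
    using abs \<open>M \<ge> 0\<close> by (intro norm_blinfun_bound) auto
  ultimately show ?thesis
    using that by blast
qed

text \<open>For \<open>m > 0\<close> this separates \<open>C\<close> from the open ball of radius
  \<open>m\<close> about 0; it is \<open>Mazur_Orlicz\<close> with the norm as dominating
  functional.\<close>

lemma convex_norm_separation:
  fixes C :: "'a::real_normed_vector set"
  assumes "convex C" "\<And>c. c \<in> C \<Longrightarrow> m \<le> norm c"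
  obtains G :: "'a dual" where "norm G \<le> 1" "\<And>c. c \<in> C \<Longrightarrow> m \<le> G c"
proof -
  obtain L :: "'a \<Rightarrow> real" where L: "linear L" "\<And>x. L x \<le> norm x" "\<And>c. c \<in> C \<Longrightarrow> m \<le> L c"
    using Mazur_Orlicz[OF sublinear_norm assms] by blast
  obtain G :: "'a dual" where "blinfun_apply G = L" "norm G \<le> 1"
    using L linear_bounded_blinfun[of L 1] by auto
  then show ?thesis
    using that L by metis
qed

text \<open>Separate the translate of \<open>W\<close> by \<open>x\<close> from the ball: a
  functional bounded below on an affine subspace vanishes on its directions.\<close>

lemma subspace_norm_separation:
  fixes W :: "'a::real_normed_vector set"
  assumes W: "subspace W" and le: "\<And>w. w \<in> W \<Longrightarrow> m \<le> norm (x + w)"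
  obtains G :: "'a dual" where "norm G \<le> 1" "m \<le> G x" "\<And>w. w \<in> W \<Longrightarrow> G w = 0"
proof -
  have "convex ((+) x ` W)"
    by (intro convex_translation subspace_imp_convex W)
  then obtain G :: "'a dual" where G: "norm G \<le> 1" "\<And>c. c \<in> (+) x ` W \<Longrightarrow> m \<le> G c"
    using convex_norm_separation[of "(+) x ` W" m] le by blast
  have "G w = 0" if w: "w \<in> W" for w
  proof (rule ccontr)
    assume "G w \<noteq> 0"
    \<comment> \<open>This \<open>t\<close> gives \<open>G (x + t *\<^sub>R w) = m - 1\<close>,
      below the bound \<open>m\<close>.\<close>
    define t where "t = (m - 1 - G x) / G w"
    have "t *\<^sub>R w \<in> W"
      using W w by (rule subspace_scale)
    then have "m \<le> G (x + t *\<^sub>R w)"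
      by (intro G) auto
    then show False
      using \<open>G w \<noteq> 0\<close> by (simp add: t_def blinfun.add_right blinfun.scaleR_right)
  qed
  moreover have "m \<le> G x"
    using G(2)[of x] subspace_0[OF W] by force
  ultimately show ?thesis
    using that G by blast
qed

lemma norming_functional:
  fixes x :: "'a::real_normed_vector"
  obtains G :: "'a dual" where "norm G \<le> 1" "G x = norm x"
proof -
  obtain G :: "'a dual" where G: "norm G \<le> 1" "norm x \<le> G x"
    using subspace_norm_separation[OF subspace_single_0, of "norm x" x] by auto
  have "G x \<le> norm G * norm x"
    using norm_blinfun[of G x] by simp
  also have "\<dots> \<le> norm x"
    using G(1) by (simp add: mult_left_le_one_le)
  finally show ?thesis
    using that G by force
qed

subsection \<open>Biduals and reflexive spaces\<close>

lemma in_span_functionals: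
  fixes S :: "'a::real_normed_vector dual set" and L :: "'a dual"
  assumes "finite S" "\<And>x. (\<forall>f\<in>S. blinfun_apply f x = 0) \<Longrightarrow> L x = 0"
  shows "L \<in> span S"
  using assms
proof (induction S arbitrary: L rule: finite_induct)
  case empty
  then have "L = 0"
    by (intro blinfun_eqI) simp
  then show ?case
    by (simp add: span_zero)
next
  case (insert f S)
  show ?case
  proof (cases "\<exists>w. (\<forall>h\<in>S. blinfun_apply h w = 0) \<and> f w \<noteq> 0")
    case True
    then obtain w where w: "\<forall>h\<in>S. blinfun_apply h w = 0" "f w \<noteq> 0"
      by blast
    have "(L - (L w / f w) *\<^sub>R f) x = 0" if "\<forall>h\<in>S. blinfun_apply h x = 0" for x
    proof -
      have "\<forall>h\<in>insert f S. blinfun_apply h (x - (f x / f w) *\<^sub>R w) = 0"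
        using that w by (auto simp: blinfun.diff_right blinfun.scaleR_right)
      then have "L (x - (f x / f w) *\<^sub>R w) = 0"
        by (rule insert.prems)
      then show ?thesis
        using w by (simp add: blinfun.diff_left blinfun.diff_right blinfun.scaleR_left
            blinfun.scaleR_right field_simps)
    qed
    then have "L - (L w / f w) *\<^sub>R f \<in> span S"
      by (rule insert.IH)
    then show ?thesis
      by (auto simp: span_insert)
  next
    case False
    then have "L \<in> span S"
      by (intro insert.IH insert.prems) auto
    then show ?thesis
      using span_mono[of S "insert f S"] by blast
  qed
qed

text \<open>The algebraic half of Helly's theorem, without control of the norm. For a new
  functional, either the solution is corrected along some \<open>w\<close> invisible to
  \<open>S\<close>, or the functional lies in \<open>span S\<close> and linearity of \<Psi> forces
  the right value.\<close>

lemma finite_functionals_solvable: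
  fixes S :: "'a::real_normed_vector dual set" and \<Psi> :: "'a dual \<Rightarrow> real"
  assumes "finite S" "linear \<Psi>"
  shows "\<exists>x. \<forall>f\<in>S. blinfun_apply f x = \<Psi> f"
  using assms(1)
proof induction
  case (insert f S)
  then obtain x where x: "\<forall>h\<in>S. blinfun_apply h x = \<Psi> h"
    by blast
  show ?case
  proof (cases "\<exists>w. (\<forall>h\<in>S. blinfun_apply h w = 0) \<and> f w \<noteq> 0")
    case True
    then obtain w where w: "\<forall>h\<in>S. blinfun_apply h w = 0" "f w \<noteq> 0"
      by blast
    show ?thesis
      using x w by (intro exI[of _ "x + ((\<Psi> f - f x) / f w) *\<^sub>R w"])
        (simp add: blinfun.add_right blinfun.scaleR_right)
  next
    case False
    then have "f \<in> span S"
      by (intro in_span_functionals insert.hyps) auto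
    moreover have "linear (\<lambda>h :: 'a dual. h x)"
      by (intro linearI) (auto simp: blinfun.add_left blinfun.scaleR_left)
    ultimately have "f x = \<Psi> f"
      using linear_eq_on_span[of "\<lambda>h. blinfun_apply h x" \<Psi> S f] assms(2) x by blast
    then show ?thesis
      using x by blast
  qed
qed simp

text \<open>Helly's theorem with slack 1. The solutions form a coset of \<open>W\<close>; if all
  were too long, some \<open>G\<close> vanishing on \<open>W\<close> would separate them from the
  ball. Such a \<open>G\<close> lies in \<open>span S\<close>, so
  \<open>G x = \<Psi> G \<le> norm \<Psi>\<close>, a contradiction.\<close>

lemma Helly_bidual:
  fixes S :: "'a::real_normed_vector dual set" and \<Psi> :: "'a dual dual"
  assumes "finite S"
  obtains x where "norm x \<le> norm \<Psi> + 1" "\<And>f. f \<in> S \<Longrightarrow> blinfun_apply f x = \<Psi> f"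
proof -
  have "linear (blinfun_apply \<Psi>)"
    by (simp add: blinfun.bounded_linear_right bounded_linear.linear)
  then obtain x where x: "\<And>f. f \<in> S \<Longrightarrow> blinfun_apply f x = \<Psi> f"
    using finite_functionals_solvable[OF assms] by blast
  define W where "W = {w. \<forall>f\<in>S. blinfun_apply f w = 0}"
  have W: "subspace W"
    by (auto simp: W_def subspace_def blinfun.add_right blinfun.scaleR_right)
  have "\<exists>w\<in>W. norm (x + w) \<le> norm \<Psi> + 1"
  proof (rule ccontr)
    assume "\<not> ?thesis"
    then have "norm \<Psi> + 1 \<le> norm (x + w)" if "w \<in> W" for w
      using that by force
    then obtain G :: "'a dual" where G: "norm G \<le> 1" "norm \<Psi> + 1 \<le> G x"
      "\<And>w. w \<in> W \<Longrightarrow> G w = 0"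
      using subspace_norm_separation[OF W] by blast
    have "G \<in> span S"
      using G(3) by (intro in_span_functionals assms) (auto simp: W_def)
    moreover have "linear (\<lambda>h :: 'a dual. h x)"
      by (intro linearI) (auto simp: blinfun.add_left blinfun.scaleR_left)
    ultimately have "G x = \<Psi> G"
      using linear_eq_on_span[of "\<lambda>h. blinfun_apply h x" \<Psi> S G] \<open>linear \<Psi>\<close> x by blast
    also have "\<dots> \<le> norm \<Psi> * norm G"
      using norm_blinfun[of \<Psi> G] by simp
    also have "\<dots> \<le> norm \<Psi>"
      using G(1) by (simp add: mult_left_le)
    finally show False
      using G(2) by simp
  qed
  then obtain w where "w \<in> W" "norm (x + w) \<le> norm \<Psi> + 1"
    by blast
  then show ?thesis
    using x by (intro that[of "x + w"]) (auto simp: W_def blinfun.add_right)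
qed

section \<open>The canonical embedding\<close>

lemma canonical_embedding_apply [simp]: "canonical_embedding x f = blinfun_apply f x"
  by (simp add: canonical_embedding.rep_eq)

lemma bounded_linear_canonical_embedding: "bounded_linear canonical_embedding"
proof (rule bounded_linear_intro[where K = 1])
  fix x :: 'a
  show "norm (canonical_embedding x) \<le> norm x * 1"
  proof (rule norm_blinfun_bound)
    fix f :: "'a dual"
    show "norm (canonical_embedding x f) \<le> norm x * 1 * norm f"
      using norm_blinfun[of f x] by (simp add: mult.commute)
  qed simp
qed (auto intro!: blinfun_eqI simp: blinfun.add_left blinfun.add_right blinfun.scaleR_left
    blinfun.scaleR_right)

text \<open>Norming functionals bound the embedding below, so its range is complete and hence
  closed; in a nonreflexive space some bidual element then has positive distance from the
  range.\<close>

lemma norm_canonical_embedding_ge: "norm x \<le> norm (canonical_embedding x)"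
proof -
  obtain G :: "'a dual" where G: "norm G \<le> 1" "G x = norm x"
    by (rule norming_functional)
  have "norm x \<le> norm (canonical_embedding x) * norm G"
    using norm_blinfun[of "canonical_embedding x" G] G(2) by simp
  also have "\<dots> \<le> norm (canonical_embedding x)"
    using G(1) by (simp add: mult_left_le)
  finally show ?thesis .
qed

lemma closed_range_canonical_embedding:
  "closed (range (canonical_embedding :: 'a::banach \<Rightarrow> 'a dual dual))"
  using complete_isometric_image[of 1 UNIV "canonical_embedding :: 'a \<Rightarrow> 'a dual dual"]
    bounded_linear_canonical_embedding norm_canonical_embedding_ge
  by (intro complete_imp_closed) (auto simp: complete_UNIV)

lemma reflexive_bounded_decreasing:
  fixes C :: "nat \<Rightarrow> 'a::banach set"
  assumes refl: "reflexive_space TYPE('a)"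
    and closed: "\<And>n. closed (C n)" and convex: "\<And>n. convex (C n)"
    and decseq: "decseq C" and x: "\<And>n. x n \<in> C n" and bounded: "\<And>n. norm (x n) \<le> M"
  obtains u where "\<And>n. u \<in> C n"
proof -
  \<comment> \<open>\<open>p f\<close> is the limsup of \<open>f (x n)\<close>, written as the
    infimum of the set \<open>A f\<close> of eventual upper bounds; \<open>M * norm f\<close> is
    always one of them.\<close>
  define A where "A = (\<lambda>f :: 'a dual. {m :: real. \<forall>\<^sub>F n in sequentially. f (x n) \<le> m})"
  define p where "p = (\<lambda>f. Inf (A f))"
  have "M \<ge> 0"
    using bounded[of 0] norm_ge_zero[of "x 0"] by linarith
  have abs: "\<bar>f (x n)\<bar> \<le> M * norm f" for f :: "'a dual" and n
    using norm_blinfun[of f "x n"] bounded[of n] mult_right_mono[OF bounded[of n], of "norm f"]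
    by (simp add: mult.commute)
  have A_bound: "M * norm f \<in> A f" for f
    using abs[of f] by (auto simp: A_def abs_le_iff)
  have upper: "p f \<le> m" if "m \<in> A f" for f m
    unfolding p_def
  proof (rule cInf_lower[OF that], rule bdd_belowI[where m = "- (M * norm f)"])
    fix a assume "a \<in> A f"
    then obtain n where "f (x n) \<le> a"
      by (auto simp: A_def eventually_sequentially)
    then show "- (M * norm f) \<le> a"
      using abs[of f n] by linarith
  qed
  have lower: "c \<le> p f" if "\<And>m. m \<in> A f \<Longrightarrow> c \<le> m" for c f
    unfolding p_def using that A_bound by (intro cInf_greatest) auto
  have "sublinear p"
    unfolding sublinear_def
  proof (intro conjI allI impI)
    fix f g
    have "p (f + g) \<le> a + b" if "a \<in> A f" "b \<in> A g" for a b
    proof (rule upper)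
      have "\<forall>\<^sub>F n in sequentially. f (x n) \<le> a" "\<forall>\<^sub>F n in sequentially. g (x n) \<le> b"
        using that by (auto simp: A_def)
      then have "\<forall>\<^sub>F n in sequentially. (f + g) (x n) \<le> a + b"
        by eventually_elim (simp add: blinfun.add_left)
      then show "a + b \<in> A (f + g)"
        by (simp add: A_def)
    qed
    then have "p (f + g) - b \<le> p f" if "b \<in> A g" for b
      using that by (intro lower) (simp add: algebra_simps)
    then have "p (f + g) - p f \<le> p g"
      by (intro lower) (simp add: algebra_simps)
    then show "p (f + g) \<le> p f + p g"
      by simp
  next
    fix c :: real and f assume c: "c > 0"
    have "p (c *\<^sub>R f) / c \<le> p f"
    proof (rule lower)
      fix a assume "a \<in> A f"
      then have "c * a \<in> A (c *\<^sub>R f)"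
        using c by (auto simp: A_def blinfun.scaleR_left)
      then show "p (c *\<^sub>R f) / c \<le> a"
        using upper c by (simp add: field_simps)
    qed
    then show "p (c *\<^sub>R f) \<le> c * p f"
      using c by (simp add: field_simps)
  qed
  then obtain L where L: "linear L" "\<And>f. L f \<le> p f"
    using Hahn_Banach_dominated by blast
  obtain \<Psi> :: "'a dual dual" where \<Psi>: "blinfun_apply \<Psi> = L"
  proof (rule linear_bounded_blinfun[OF L(1) _ \<open>M \<ge> 0\<close>])
    show "L f \<le> M * norm f" for f
      using L(2)[of f] upper[OF A_bound, of f] by linarith
  qed
  obtain u where u: "\<Psi> = canonical_embedding u"
    using refl unfolding reflexive_space_def by blast
  have "u \<in> C n" for n
  proof (rule ccontr)
    assume "u \<notin> C n"
    then obtain d where d: "d > 0" "ball u d \<subseteq> - C n"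
      using closed[of n] by (meson ComplI open_Compl open_contains_ball)
    have "convex ((\<lambda>y. y - u) ` C n)"
      by (intro convex_translation_subtract convex)
    moreover have "d \<le> norm c" if "c \<in> (\<lambda>y. y - u) ` C n" for c
      using that d(2) by (force simp: dist_norm norm_minus_commute)
    ultimately obtain G :: "'a dual" where G: "\<And>c. c \<in> (\<lambda>y. y - u) ` C n \<Longrightarrow> d \<le> G c"
      using convex_norm_separation by blast
    \<comment> \<open>\<open>L\<close> is controlled by \<open>p\<close> only from above, so the
      lower bound of \<open>G\<close> on \<open>C n\<close> is used through \<open>- G\<close>; it
      holds for all later \<open>x k\<close> because the sets decrease.\<close>
    have "(- G) (x k) \<le> - G u - d" if "k \<ge> n" for k
    proof -
      have "x k \<in> C n"
        using decseqD[OF decseq that] x by blast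
      then have "d \<le> G (x k - u)"
        by (intro G) auto
      then show ?thesis
        by (simp add: blinfun.diff_right blinfun.minus_left)
    qed
    then have "- G u - d \<in> A (- G)"
      unfolding A_def eventually_sequentially by blast
    then have "\<Psi> (- G) \<le> - G u - d"
      using upper L(2) \<Psi> order_trans by fastforce
    then show False
      using d(1) by (simp add: u blinfun.minus_left)
  qed
  then show ?thesis
    using that by blast
qed

section \<open>Sublevel sets of \<open>V\<close> and existence of projections\<close>

lemma convex_norm_power2: "convex_on UNIV (\<lambda>x :: 'a::real_normed_vector. (norm x)\<^sup>2)"
proof (rule convex_onI)
  fix t :: real and x y :: 'a
  assume t: "0 < t" "t < 1"
  have "(norm ((1 - t) *\<^sub>R x + t *\<^sub>R y))\<^sup>2 \<le> ((1 - t) * norm x + t * norm y)\<^sup>2"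
    using t norm_triangle_ineq[of "(1 - t) *\<^sub>R x" "t *\<^sub>R y"] by (intro power_mono) auto
  also have "\<dots> = (1 - t) * (norm x)\<^sup>2 + t * (norm y)\<^sup>2 - t * (1 - t) * (norm x - norm y)\<^sup>2"
    by (simp add: power2_eq_square algebra_simps)
  also have "\<dots> \<le> (1 - t) * (norm x)\<^sup>2 + t * (norm y)\<^sup>2"
    using t by simp
  finally show "(norm ((1 - t) *\<^sub>R x + t *\<^sub>R y))\<^sup>2 \<le> (1 - t) * (norm x)\<^sup>2 + t * (norm y)\<^sup>2" .
qed simp

lemma convex_sublevel_V: "convex {y. V \<phi> y \<le> r}"
proof (rule convexI, clarify)
  fix x y and s t :: real
  assume *: "V \<phi> x \<le> r" "V \<phi> y \<le> r" "0 \<le> s" "0 \<le> t" "s + t = 1"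
  have "(norm (s *\<^sub>R x + t *\<^sub>R y))\<^sup>2 \<le> s * (norm x)\<^sup>2 + t * (norm y)\<^sup>2"
    using * convex_norm_power2[where 'a = 'a] unfolding convex_on_def by blast
  moreover have "s * (norm \<phi>)\<^sup>2 + t * (norm \<phi>)\<^sup>2 = (norm \<phi>)\<^sup>2"
    using * by (metis distrib_right mult_1)
  ultimately have "V \<phi> (s *\<^sub>R x + t *\<^sub>R y) \<le> s * V \<phi> x + t * V \<phi> y"
    by (simp add: V_def blinfun.add_right blinfun.scaleR_right algebra_simps)
  also have "\<dots> \<le> r"
    using * convex_bound_le by blast
  finally show "V \<phi> (s *\<^sub>R x + t *\<^sub>R y) \<le> r" .
qed

lemma closed_sublevel_V: "closed {y. V \<phi> y \<le> r}"
  unfolding V_def by (intro closed_Collect_le continuous_intros)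

text \<open>The source of both the nonnegativity of \<open>V\<close> and the boundedness of its
  sublevel sets.\<close>

lemma V_ge: "(norm \<phi> - norm y)\<^sup>2 \<le> V \<phi> y"
  using norm_blinfun[of \<phi> y] by (simp add: V_def power2_eq_square algebra_simps)

lemma reflexive_imp_generalized_projection:
  fixes C :: "'a::banach set"
  assumes refl: "reflexive_space TYPE('a)" and C: "C \<noteq> {}" "closed C" "convex C"
  shows "generalized_projection C \<phi> \<noteq> {}"
proof -
  define m where "m = (INF y\<in>C. V \<phi> y)"
  have nonneg: "0 \<le> V \<phi> y" for y
    using V_ge[of \<phi> y] zero_le_power2 order_trans by blast
  then have bdd: "bdd_below (V \<phi> ` C)"
    by (intro bdd_belowI2[where m = 0])
  \<comment> \<open>Near-minimizers with error \<open>1 / Suc n\<close>: all lie in the sublevel set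
    at \<open>m + 1\<close>, which bounds them uniformly, and a common point has value at most
    \<open>m\<close>.\<close>
  define D where "D = (\<lambda>n. C \<inter> {y. V \<phi> y \<le> m + 1 / Suc n})"
  have "\<exists>y. y \<in> D n" for n
  proof -
    have "m < m + 1 / Suc n"
      by simp
    then obtain y where "y \<in> C" "V \<phi> y < m + 1 / Suc n"
      unfolding m_def using cINF_less_iff[OF C(1) bdd] by blast
    then show ?thesis
      by (auto simp: D_def)
  qed
  then obtain x where x: "\<And>n. x n \<in> D n"
    by metis
  have "norm (x n) \<le> norm \<phi> + sqrt (m + 1)" for n
  proof -
    have "(norm \<phi> - norm (x n))\<^sup>2 \<le> m + 1 / Suc n"
      using x[of n] V_ge[of \<phi> "x n"] by (simp add: D_def)
    also have "\<dots> \<le> m + 1"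
      by simp
    finally have "\<bar>norm \<phi> - norm (x n)\<bar> \<le> sqrt (m + 1)"
      using real_le_rsqrt real_sqrt_le_mono real_sqrt_abs by metis
    then show ?thesis
      by linarith
  qed
  moreover have "decseq D"
  proof (rule decseq_SucI)
    fix n
    have "m + 1 / Suc (Suc n) \<le> m + 1 / Suc n"
      by (simp add: frac_le)
    then show "D (Suc n) \<subseteq> D n"
      unfolding D_def by (auto intro: order_trans)
  qed
  moreover have "closed (D n)" "convex (D n)" for n
    unfolding D_def by (intro closed_Int convex_Int C closed_sublevel_V convex_sublevel_V)+
  ultimately obtain u where u: "\<And>n. u \<in> D n"
    using reflexive_bounded_decreasing[OF refl, of D x "norm \<phi> + sqrt (m + 1)"] x by metis
  have "V \<phi> u \<le> m"
  proof (rule tendsto_lowerbound)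
    show "(\<lambda>n. m + 1 / Suc n) \<longlonglongrightarrow> m"
      using LIMSEQ_inverse_real_of_nat_add[of m] by (simp add: inverse_eq_divide)
    show "\<forall>\<^sub>F n in sequentially. V \<phi> u \<le> m + 1 / Suc n"
      using u by (auto simp: D_def)
  qed simp
  moreover have "m \<le> V \<phi> u"
    unfolding m_def using u by (intro cINF_lower bdd) (auto simp: D_def)
  moreover have "u \<in> C"
    using u by (simp add: D_def)
  ultimately have "u \<in> generalized_projection C \<phi>"
    unfolding generalized_projection_def m_def by simp
  then show ?thesis
    by blast
qed

subsection \<open>James's sequence construction\<close>

lemma sublinear_continuous_on:
  fixes N :: "'a::real_normed_vector \<Rightarrow> real"
  assumes N: "sublinear N" and le: "\<And>x. N x \<le> norm x"
  shows "continuous_on S N"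
proof -
  have "N x - N y \<le> norm (x - y)" for x y
    using sublinear_add[OF N, of "x - y" y] le[of "x - y"] by simp
  from this this have "\<bar>N x - N y\<bar> \<le> norm (x - y)" for x y
    by (metis abs_diff_le_iff abs_le_iff minus_diff_eq norm_minus_commute)
  then have "1-lipschitz_on S N"
    by (intro lipschitz_onI) (auto simp: dist_norm)
  then show ?thesis
    by (rule lipschitz_on_continuous_on)
qed

text \<open>The weights of the terms from \<open>n\<close> to \<open>m - 1\<close> and of
  \<open>w\<close> add up to \<open>(1/2)^n\<close>, so this tail is \<open>(1/2)^n\<close> times
  one point of \<open>W\<close>. The induction merges the last term and \<open>w\<close>, which
  carry equal weight, into their midpoint.\<close>

lemma dyadic_average_in_convex:
  fixes u :: "nat \<Rightarrow> 'a::real_vector"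
  assumes W: "convex W" and "n \<le> m" and u: "\<And>i. n \<le> i \<Longrightarrow> i < m \<Longrightarrow> u i \<in> W" and "w \<in> W"
  shows "\<exists>w'\<in>W. (\<Sum>i<m. (1/2)^Suc i *\<^sub>R u i) + (1/2)^m *\<^sub>R w
    = (\<Sum>i<n. (1/2)^Suc i *\<^sub>R u i) + (1/2)^n *\<^sub>R w'"
  using assms(2-)
proof (induction m arbitrary: w rule: dec_induct)
  case base
  then show ?case
    by blast
next
  case (step k)
  have "(1/2) *\<^sub>R u k + (1/2) *\<^sub>R w \<in> W"
    using step by (intro convexD[OF W]) auto
  then have "\<exists>w'\<in>W. (\<Sum>i<k. (1/2)^Suc i *\<^sub>R u i) + (1/2)^k *\<^sub>R ((1/2) *\<^sub>R u k + (1/2) *\<^sub>R w)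
    = (\<Sum>i<n. (1/2)^Suc i *\<^sub>R u i) + (1/2)^n *\<^sub>R w'"
    using step.prems by (intro step.IH) auto
  then show ?case
    by (simp add: scaleR_add_right mult.commute add.assoc)
qed

text \<open>The choice of \<open>u n\<close> makes \<open>T n + (1/2)^n *\<^sub>R u n\<close> nearly \<open>N\<close>-minimal among the admissible
  continuations of \<open>T n\<close>, hence at most slightly \<open>N\<close>-larger than the limit \<open>g\<close>. As \<open>T (Suc n)\<close> is the
  midpoint of that element and \<open>T n\<close>, the deficit of \<open>N (T n)\<close> decays only like \<open>(1/2)^n\<close>, which is
  the weight of the remaining tail.\<close>

lemma James_sequence:
  fixes f :: "nat \<Rightarrow> 'a::banach" and N :: "'a \<Rightarrow> real"
  assumes N: "sublinear N" and N_le: "\<And>x. N x \<le> norm x"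
    and bounded: "\<And>n. norm (f n) \<le> K"
    and "\<theta> > 0" and \<theta>: "\<And>v. v \<in> convex hull (range f) \<Longrightarrow> \<theta> \<le> N v"
  obtains g T where "0 < N g" "\<And>n. N (T n) \<le> N g * (1 - (1/2)^n / 2)"
    "\<And>n. \<exists>v\<in>closure (convex hull (f ` {n..})). g = T n + (1/2)^n *\<^sub>R v"
proof -
  define H where "H = (\<lambda>n. convex hull (f ` {n..}))"
  have H: "convex (H n)" "H n \<noteq> {}" for n
    by (auto simp: H_def)
  have H_mono: "H m \<subseteq> H n" if "n \<le> m" for m n
    unfolding H_def using that by (intro hull_mono) auto
  define S where "S = (\<lambda>u n. \<Sum>i<n. (1/2 :: real)^Suc i *\<^sub>R (u i :: 'a))"
  \<comment> \<open>Since the hulls decrease, everything added from stage \<open>n\<close> on can be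
    read as one point of \<open>H n\<close>.\<close>
  have in_H: "\<exists>w'\<in>H n. S u m + (1/2)^m *\<^sub>R w = S u n + (1/2)^n *\<^sub>R w'"
    if "n \<le> m" "\<And>i. n \<le> i \<Longrightarrow> i < m \<Longrightarrow> u i \<in> H i" "w \<in> H m" for u w m n
    unfolding S_def using that H_mono by (intro dyadic_average_in_convex H) blast+
  \<comment> \<open>Read from stage 0, the whole sum is a point of the convex hull of the
    \<open>f i\<close>.\<close>
  have N_ge: "\<theta> \<le> N (S u m + (1/2)^m *\<^sub>R w)" if "\<And>i. i < m \<Longrightarrow> u i \<in> H i" "w \<in> H m" for u w m
    using in_H[of 0 m u w] that \<theta> by (auto simp: S_def H_def)
  \<comment> \<open>The relative slack is quadratic in \<open>(1/2)^n\<close>, small against the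
    linear deficit to be kept. It leaves room for a choice because the infimum is at least
    \<open>\<theta> > 0\<close>.\<close>
  define P where "P = (\<lambda>u n r. r \<in> H n \<and> (\<forall>v\<in>H n.
    N (S u n + (1/2)^n *\<^sub>R r) \<le> (1 + ((1/2)^n)\<^sup>2 / 4) * N (S u n + (1/2)^n *\<^sub>R v)))"
  \<comment> \<open>\<open>S u n\<close> involves only the \<open>u i\<close> with
    \<open>i < n\<close>, so the terms can be chosen one after another.\<close>
  have "\<exists>u. \<forall>n. P u n (u n)"
  proof (rule dependent_wellorder_choice)
    fix r n and u u' :: "nat \<Rightarrow> 'a"
    assume "\<And>y. y < n \<Longrightarrow> u y = u' y"
    then have "S u n = S u' n"
      by (simp add: S_def)
    then show "P u n r = P u' n r"
      by (simp add: P_def)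
  next
    fix n u
    assume "\<And>y. y < n \<Longrightarrow> P u y (u y)"
    then have ge: "\<theta> \<le> N (S u n + (1/2)^n *\<^sub>R v)" if "v \<in> H n" for v
      using that by (intro N_ge) (auto simp: P_def)
    define I where "I = (INF v\<in>H n. N (S u n + (1/2)^n *\<^sub>R v))"
    have bdd: "bdd_below ((\<lambda>v. N (S u n + (1/2)^n *\<^sub>R v)) ` H n)"
      using ge by (intro bdd_belowI2[where m = \<theta>])
    have "\<theta> \<le> I"
      unfolding I_def using ge H by (intro cINF_greatest)
    then have "I < (1 + ((1/2)^n)\<^sup>2 / 4) * I"
      using \<open>\<theta> > 0\<close> by simp
    then obtain r where r: "r \<in> H n" "N (S u n + (1/2)^n *\<^sub>R r) < (1 + ((1/2)^n)\<^sup>2 / 4) * I"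
      unfolding I_def using cINF_less_iff[OF H(2) bdd] by blast
    have "(1 + ((1/2)^n)\<^sup>2 / 4) * I \<le> (1 + ((1/2)^n)\<^sup>2 / 4) * N (S u n + (1/2)^n *\<^sub>R v)"
      if "v \<in> H n" for v
      unfolding I_def using that by (intro mult_left_mono cINF_lower bdd) auto
    then show "\<exists>r. P u n r"
      using r unfolding P_def by (intro exI[of _ r]) (auto intro: less_imp_le order_trans)
  qed
  then obtain u where "\<forall>n. P u n (u n)"
    by blast
  then have u: "u n \<in> H n" and near_min: "v \<in> H n \<Longrightarrow>
    N (S u n + (1/2)^n *\<^sub>R u n) \<le> (1 + ((1/2)^n)\<^sup>2 / 4) * N (S u n + (1/2)^n *\<^sub>R v)" for n v
    by (auto simp: P_def)
  define T where "T = S u"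
  define p where "p = (\<lambda>n. T n + (1/2)^n *\<^sub>R u n)"
  have "H n \<subseteq> cball 0 K" for n
    unfolding H_def using bounded by (intro hull_minimal) auto
  then have norm_u: "norm (u n) \<le> K" for n
    using u by force
  have summ: "summable (\<lambda>i. (1/2 :: real)^Suc i *\<^sub>R u i)"
  proof (rule summable_comparison_test)
    show "summable (\<lambda>i. (1/2)^Suc i * K)"
      by (intro summable_mult2) (simp add: summable_geometric)
    show "\<exists>N. \<forall>n\<ge>N. norm ((1/2 :: real)^Suc n *\<^sub>R u n) \<le> (1/2)^Suc n * K"
      using norm_u by (auto simp: mult_left_mono)
  qed
  define g where "g = (\<Sum>i. (1/2 :: real)^Suc i *\<^sub>R u i)"
  have T_lim: "T \<longlonglongrightarrow> g"
    unfolding T_def S_def g_def using summ by (rule summable_LIMSEQ)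
  \<comment> \<open>Doubling the weight \<open>(1/2)^Suc n\<close> gives \<open>p n\<close>, and the
    terms of a convergent series vanish in the limit.\<close>
  have "(\<lambda>n. T n + 2 *\<^sub>R ((1/2 :: real)^Suc n *\<^sub>R u n)) \<longlonglongrightarrow> g + 2 *\<^sub>R 0"
    by (intro tendsto_intros T_lim summable_LIMSEQ_zero summ)
  then have p_lim: "p \<longlonglongrightarrow> g"
    by (simp add: p_def)
  have Np_lim: "(\<lambda>n. N (p n)) \<longlonglongrightarrow> N g"
    using continuous_on_tendsto_compose[OF sublinear_continuous_on[OF N N_le, of UNIV] p_lim] by simp
  have p_in: "\<exists>w\<in>H n. p m = T n + (1/2)^n *\<^sub>R w" if "n \<le> m" for m n
    unfolding p_def T_def using that u by (intro in_H)
  have "\<theta> \<le> N (p n)" for n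
    unfolding p_def T_def using u by (intro N_ge)
  then have "\<theta> \<le> N g"
    by (intro tendsto_lowerbound[OF Np_lim]) auto
  then have pos: "0 < N g"
    using \<open>\<theta> > 0\<close> by linarith
  \<comment> \<open>For \<open>m \<ge> n\<close> the point \<open>p m\<close> is itself an
    admissible continuation of \<open>T n\<close>, so near-minimality compares \<open>p n\<close>
    with it; then \<open>m\<close> tends to infinity.\<close>
  have Np: "N (p n) \<le> (1 + ((1/2)^n)\<^sup>2 / 4) * N g" for n
  proof (rule tendsto_lowerbound)
    show "(\<lambda>m. (1 + ((1/2)^n)\<^sup>2 / 4) * N (p m)) \<longlonglongrightarrow> (1 + ((1/2)^n)\<^sup>2 / 4) * N g"
      by (intro tendsto_intros Np_lim)
    show "\<forall>\<^sub>F m in sequentially. N (p n) \<le> (1 + ((1/2)^n)\<^sup>2 / 4) * N (p m)"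
      unfolding eventually_sequentially
    proof (intro exI[of _ n] allI impI)
      fix m assume "n \<le> m"
      then obtain w where "w \<in> H n" "p m = T n + (1/2)^n *\<^sub>R w"
        using p_in by blast
      then show "N (p n) \<le> (1 + ((1/2)^n)\<^sup>2 / 4) * N (p m)"
        using near_min[of w n] by (simp add: p_def T_def)
    qed
  qed simp
  \<comment> \<open>The quadratic term strengthens the induction: it makes the bound 0 at
    \<open>n = 0\<close>, where \<open>T 0 = 0\<close>, and averaging with the bound on
    \<open>p n\<close> reproduces the same formula exactly for \<open>a / 2\<close>.\<close>
  have NT: "N (T n) \<le> N g * (1 - (1/2)^n / 2 - ((1/2)^n)\<^sup>2 / 2)" for n
  proof (induction n)
    case 0
    then show ?case
      by (simp add: T_def S_def sublinear_0[OF N])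
  next
    case (Suc n)
    define a where "a = (1/2 :: real)^n"
    have "T n = (1/2) *\<^sub>R T n + (1/2) *\<^sub>R T n"
      by (simp flip: scaleR_left_distrib)
    moreover have "T (Suc n) = T n + (1/2) *\<^sub>R ((1/2)^n *\<^sub>R u n)"
      by (simp add: T_def S_def)
    ultimately have "T (Suc n) = (1/2) *\<^sub>R T n + (1/2) *\<^sub>R p n"
      unfolding p_def scaleR_add_right by (metis add.assoc)
    then have "N (T (Suc n)) \<le> (1/2) * N (T n) + (1/2) * N (p n)"
      using sublinear_add[OF N, of "(1/2) *\<^sub>R T n" "(1/2) *\<^sub>R p n"]
        sublinear_scaleR[OF N, of "1/2"] by simp
    also have "\<dots> \<le> (1/2) * (N g * (1 - a / 2 - a\<^sup>2 / 2)) + (1/2) * ((1 + a\<^sup>2 / 4) * N g)"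
      using Suc.IH Np[of n] unfolding a_def by (intro add_mono mult_left_mono) auto
    also have "\<dots> = N g * (1 - (a / 2) / 2 - (a / 2)\<^sup>2 / 2)"
      by (simp add: field_simps power2_eq_square)
    finally show ?case
      by (simp add: a_def)
  qed
  have "N (T n) \<le> N g * (1 - (1/2)^n / 2)" for n
  proof (rule order_trans[OF NT])
    show "N g * (1 - (1/2)^n / 2 - ((1/2)^n)\<^sup>2 / 2) \<le> N g * (1 - (1/2)^n / 2)"
      using pos by (intro mult_left_mono) auto
  qed
  \<comment> \<open>The rescaled tail of \<open>g\<close> is a limit of points of
    \<open>H n\<close>, hence the closure.\<close>
  moreover have "\<exists>v\<in>closure (convex hull (f ` {n..})). g = T n + (1/2)^n *\<^sub>R v" for n
  proof (rule bexI)
    have "(\<lambda>m. 2^n *\<^sub>R (p m - T n)) \<longlonglongrightarrow> 2^n *\<^sub>R (g - T n)"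
      by (intro tendsto_intros p_lim)
    moreover have "\<forall>\<^sub>F m in sequentially. 2^n *\<^sub>R (p m - T n) \<in> closure (H n)"
      unfolding eventually_sequentially
    proof (intro exI[of _ n] allI impI)
      fix m assume "n \<le> m"
      then obtain w where "w \<in> H n" "p m = T n + (1/2)^n *\<^sub>R w"
        using p_in by blast
      then show "2^n *\<^sub>R (p m - T n) \<in> closure (H n)"
        using closure_subset[of "H n"] by (auto simp: power_one_over)
    qed
    ultimately have "2^n *\<^sub>R (g - T n) \<in> closure (H n)"
      by (intro Lim_in_closed_set[of "closure (H n)" _ sequentially]) auto
    then show "2^n *\<^sub>R (g - T n) \<in> closure (convex hull (f ` {n..}))"
      by (simp add: H_def)
    show "g = T n + (1/2)^n *\<^sub>R (2^n *\<^sub>R (g - T n))"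
      by (simp add: power_one_over)
  qed
  ultimately show ?thesis
    using that pos by blast
qed

subsection \<open>Nonreflexive spaces\<close>

text \<open>Separation in the bidual gives \<Phi> that vanishes on the embedded space, with
  \<open>\<Phi> F = d > 0\<close>. Helly for \<Phi> yields \<open>f n\<close> with
  \<open>F (f n) = d\<close> that vanishes at the earlier points; Helly for \<open>F\<close> then
  yields \<open>x n\<close> at which \<open>f 0\<close>, ..., \<open>f n\<close> all take the value
  \<open>d\<close>.\<close>

lemma nonreflexive_triangular_sequences:
  assumes "\<not> reflexive_space TYPE('a::banach)"
  obtains x :: "nat \<Rightarrow> 'a::banach" and f :: "nat \<Rightarrow> 'a dual" and d M :: real
  where "d > 0" "\<And>n. norm (x n) \<le> M" "\<And>n. norm (f n) \<le> 2"
    "\<And>n k. n \<le> k \<Longrightarrow> f n (x k) = d" "\<And>n k. k < n \<Longrightarrow> f n (x k) = 0"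
proof -
  let ?J = "canonical_embedding :: 'a \<Rightarrow> 'a dual dual"
  obtain F where F: "F \<notin> range ?J"
    using assms unfolding reflexive_space_def by blast
  then obtain \<delta> where \<delta>: "\<delta> > 0" "ball F \<delta> \<subseteq> - range ?J"
    using closed_range_canonical_embedding by (meson ComplI open_Compl open_contains_ball)
  have sub: "subspace (range ?J)"
    using bounded_linear_canonical_embedding
    by (intro linear_subspace_image bounded_linear.linear subspace_UNIV)
  have "\<delta> \<le> norm (F + w)" if "w \<in> range ?J" for w
  proof (rule ccontr)
    assume "\<not> \<delta> \<le> norm (F + w)"
    then have "- w \<in> ball F \<delta>"
      by (simp add: dist_norm)
    then show False
      using \<delta>(2) subspace_neg[OF sub that] by blast
  qed
  then obtain \<Phi> :: "'a dual dual dual" where \<Phi>: "norm \<Phi> \<le> 1" "\<delta> \<le> \<Phi> F"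
    "\<And>w. w \<in> range ?J \<Longrightarrow> \<Phi> w = 0"
    using subspace_norm_separation[OF sub] by blast
  define d where "d = \<Phi> F"
  \<comment> \<open>The condition \<open>F (fst r) = d\<close> is the invariant that lets every
    later point take the value \<open>d\<close> under this functional.\<close>
  define P where "P = (\<lambda>(s :: nat \<Rightarrow> 'a dual \<times> 'a) n (r :: 'a dual \<times> 'a).
    norm (fst r) \<le> 2 \<and> F (fst r) = d \<and>
    norm (snd r) \<le> norm F + 1 \<and> (\<forall>k<n. blinfun_apply (fst r) (snd (s k)) = 0) \<and>
    (\<forall>k<n. blinfun_apply (fst (s k)) (snd r) = d) \<and> blinfun_apply (fst r) (snd r) = d)"
  have "\<exists>s :: nat \<Rightarrow> 'a dual \<times> 'a. \<forall>n. P s n (s n)"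
  proof (rule dependent_wellorder_choice)
    fix n and s :: "nat \<Rightarrow> 'a dual \<times> 'a"
    assume IH: "\<And>k. k < n \<Longrightarrow> P s k (s k)"
    define S where "S = insert F ((\<lambda>k. ?J (snd (s k))) ` {..<n})"
    have "finite S"
      by (simp add: S_def)
    then obtain h where h: "norm h \<le> norm \<Phi> + 1" "\<And>G. G \<in> S \<Longrightarrow> blinfun_apply G h = \<Phi> G"
      using Helly_bidual[of S \<Phi>] by blast
    have h0: "h (snd (s k)) = 0" if "k < n" for k
      using h(2)[of "?J (snd (s k))"] \<Phi>(3)[of "?J (snd (s k))"] that by (auto simp: S_def)
    have hd: "F h = d"
      using h(2)[of F] by (simp add: S_def d_def)
    obtain y where y: "norm y \<le> norm F + 1"
      "\<And>k. k \<in> insert h ((\<lambda>k. fst (s k)) ` {..<n}) \<Longrightarrow> blinfun_apply k y = F k"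
      using Helly_bidual[of "insert h ((\<lambda>k. fst (s k)) ` {..<n})" F] by auto
    have "P s n (h, y)"
      using h(1) \<Phi>(1) h0 hd y IH by (auto simp: P_def)
    then show "\<exists>r. P s n r" ..
  qed (simp add: P_def)
  then obtain s :: "nat \<Rightarrow> 'a dual \<times> 'a" where "\<forall>n. P s n (s n)"
    by blast
  then have s: "norm (snd (s n)) \<le> norm F + 1" "norm (fst (s n)) \<le> 2"
    "k < n \<Longrightarrow> fst (s n) (snd (s k)) = 0" "k < n \<Longrightarrow> fst (s k) (snd (s n)) = d"
    "fst (s n) (snd (s n)) = d" for n k
    by (auto simp: P_def)
  show ?thesis
  proof (rule that[of d "\<lambda>n. snd (s n)" "norm F + 1" "\<lambda>n. fst (s n)"])
    show "d > 0"
      using \<Phi>(2) \<delta>(1) by (simp add: d_def)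
    show "fst (s n) (snd (s k)) = d" if "n \<le> k" for n k
      using that s(4,5) by (cases "n = k") auto
  qed (use s in auto)
qed

text \<open>For a subspace \<open>Y\<close> this is the norm of the restriction of \<open>h\<close>
  to \<open>Y\<close>; symmetry of the ball replaces the absolute value. The functionals stay
  defined on the whole space, so it is a seminorm on the dual.\<close>

definition norm_on :: "'a::real_normed_vector set \<Rightarrow> 'a dual \<Rightarrow> real" where
  "norm_on Y h = (SUP y\<in>Y \<inter> cball 0 1. h y)"

lemma norm_on_upper:
  assumes "y \<in> Y" "norm y \<le> 1"
  shows "blinfun_apply h y \<le> norm_on Y h"
  unfolding norm_on_def
proof (rule cSUP_upper)
  show "bdd_above (blinfun_apply h ` (Y \<inter> cball 0 1))"
  proof (rule bdd_aboveI2[where M = "norm h"])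
    fix z assume "z \<in> Y \<inter> cball 0 1"
    then show "h z \<le> norm h"
      using norm_blinfun[of h z] mult_left_le[of "norm z" "norm h"] by simp
  qed
qed (use assms in auto)

lemma norm_on_least:
  assumes "0 \<in> Y" "\<And>y. y \<in> Y \<Longrightarrow> norm y \<le> 1 \<Longrightarrow> blinfun_apply h y \<le> m"
  shows "norm_on Y h \<le> m"
  unfolding norm_on_def
proof (rule cSUP_least)
  have "0 \<in> Y \<inter> cball 0 1"
    using assms(1) by simp
  then show "Y \<inter> cball 0 1 \<noteq> {}"
    by blast
qed (use assms in auto)

lemma norm_on_le_norm:
  assumes "0 \<in> Y"
  shows "norm_on Y h \<le> norm h"
proof (rule norm_on_least[OF assms])
  fix y :: 'a assume "norm y \<le> 1"
  then show "h y \<le> norm h"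
    using norm_blinfun[of h y] mult_left_le[of "norm y" "norm h"] by simp
qed

lemma sublinear_norm_on:
  assumes "0 \<in> Y"
  shows "sublinear (norm_on Y)"
  unfolding sublinear_def
proof (intro conjI allI impI)
  fix g h
  show "norm_on Y (g + h) \<le> norm_on Y g + norm_on Y h"
    by (rule norm_on_least[OF assms]) (auto simp: blinfun.add_left intro: add_mono norm_on_upper)
next
  fix c :: real and h assume "c > 0"
  then show "norm_on Y (c *\<^sub>R h) \<le> c * norm_on Y h"
    by (intro norm_on_least[OF assms])
      (auto simp: blinfun.scaleR_left intro: mult_left_mono norm_on_upper)
qed

text \<open>At a finite combination of the \<open>x k\<close> the values \<open>f n\<close> are
  eventually 0; the uniform norm bound carries smallness to the closure.\<close>

lemma functionals_eventually_small_on_closure_span: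
  fixes f :: "nat \<Rightarrow> 'a::real_normed_vector dual"
  assumes f: "\<And>n. norm (f n) \<le> M" and zero: "\<And>n k. k < n \<Longrightarrow> f n (x k) = 0"
    and y: "y \<in> closure (span (range x))" and "c > 0"
  shows "\<forall>\<^sub>F n in sequentially. f n y < c"
proof -
  have "M \<ge> 0"
    using f[of 0] norm_ge_zero[of "f 0"] by linarith
  \<comment> \<open>\<open>M + 1\<close> keeps the denominator positive even if
    \<open>M = 0\<close>.\<close>
  then have "c / (M + 1) > 0"
    using \<open>c > 0\<close> by simp
  then obtain z where z: "z \<in> span (range x)" "dist z y < c / (M + 1)"
    using y unfolding closure_approachable by blast
  have "span (range x) \<subseteq> {z. \<forall>\<^sub>F n in sequentially. f n z = 0}"
  proof (rule span_minimal)
    show "range x \<subseteq> {z. \<forall>\<^sub>F n in sequentially. f n z = 0}"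
      using zero by (auto simp: eventually_sequentially intro: Suc_le_lessD)
    show "subspace {z. \<forall>\<^sub>F n in sequentially. f n z = 0}"
      by (auto simp: subspace_def blinfun.add_right blinfun.scaleR_right
          elim: eventually_elim2 eventually_mono)
  qed
  then have "\<forall>\<^sub>F n in sequentially. f n z = 0"
    using z(1) by blast
  then show ?thesis
  proof eventually_elim
    case (elim n)
    have "f n y = f n (y - z)"
      using elim by (simp add: blinfun.diff_right)
    also have "\<dots> \<le> norm (f n) * norm (y - z)"
      using norm_blinfun[of "f n" "y - z"] by simp
    also have "\<dots> \<le> (M + 1) * norm (y - z)"
      using f[of n] by (intro mult_right_mono) auto
    also have "\<dots> < c"
      using z(2) \<open>M \<ge> 0\<close> by (simp add: dist_norm norm_minus_commute field_simps)
    finally show ?case .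
  qed
qed

lemma blinfun_le_on_closure_convex_hull:
  fixes A :: "'a::real_normed_vector dual set"
  assumes "v \<in> closure (convex hull A)" "\<And>h. h \<in> A \<Longrightarrow> blinfun_apply h y \<le> c"
  shows "v y \<le> c"
proof -
  have "convex hull A \<subseteq> {h. blinfun_apply h y \<le> c}"
  proof (rule hull_minimal)
    show "convex {h. blinfun_apply h y \<le> c}"
      by (auto simp: convex_def blinfun.add_left blinfun.scaleR_left intro: convex_bound_le)
  qed (use assms(2) in auto)
  moreover have "closed {h. blinfun_apply h y \<le> c}"
    by (intro closed_Collect_le continuous_intros)
  ultimately show ?thesis
    using assms(1) closure_minimal by blast
qed

lemma subspace_closure:
  fixes S :: "'a::real_normed_vector set"
  assumes S: "subspace S"
  shows "subspace (closure S)"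
  unfolding subspace_def
proof (intro conjI ballI allI)
  show "0 \<in> closure S"
    using subspace_0[OF S] closure_subset by blast
next
  fix x y assume "x \<in> closure S" "y \<in> closure S"
  then obtain a b where "\<And>n. a n \<in> S" "a \<longlonglongrightarrow> x" "\<And>n. b n \<in> S" "b \<longlonglongrightarrow> y"
    unfolding closure_sequential by blast
  then show "x + y \<in> closure S"
    unfolding closure_sequential
    by (intro exI[of _ "\<lambda>n. a n + b n"]) (simp add: tendsto_add subspace_add[OF S])
next
  fix c :: real and x assume "x \<in> closure S"
  then obtain a where "\<And>n. a n \<in> S" "a \<longlonglongrightarrow> x"
    unfolding closure_sequential by blast
  then show "c *\<^sub>R x \<in> closure S"
    unfolding closure_sequential
    by (intro exI[of _ "\<lambda>n. c *\<^sub>R a n"]) (simp add: tendsto_scaleR subspace_scale[OF S])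
qed

text \<open>Put \<open>a = (1/2)^n\<close>. On the unit ball of \<open>Y\<close> the head
  \<open>T n\<close> falls short of the norm of \<open>g\<close> by at least \<open>a / 2\<close>
  times that norm. At a fixed \<open>y\<close> and large \<open>n\<close> the tail returns at most
  \<open>a / 4\<close> times it, since the later \<open>f k y\<close> stay below a quarter of the
  norm.\<close>

lemma nonreflexive_not_norm_attaining:
  assumes "\<not> reflexive_space TYPE('a::banach)"
  obtains Y :: "'a::banach set" and g :: "'a dual" where "subspace Y" "closed Y" "0 < norm_on Y g"
    "\<And>y. y \<in> Y \<Longrightarrow> norm y \<le> 1 \<Longrightarrow> g y < norm_on Y g"
proof -
  obtain x :: "nat \<Rightarrow> 'a" and f :: "nat \<Rightarrow> 'a dual" and d M :: real
    where "d > 0" and x: "\<And>n. norm (x n) \<le> M" and f: "\<And>n. norm (f n) \<le> 2"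
      and fx: "\<And>n k. n \<le> k \<Longrightarrow> f n (x k) = d" "\<And>n k. k < n \<Longrightarrow> f n (x k) = 0"
    by (rule nonreflexive_triangular_sequences[OF assms]) (rule that)
  define Y where "Y = closure (span (range x))"
  have Y: "subspace Y" "closed Y"
    unfolding Y_def by (auto intro: subspace_closure)
  then have "0 \<in> Y"
    by (simp add: subspace_0)
  have "x 0 \<noteq> 0"
    using fx(1)[of 0 0] \<open>d > 0\<close> by auto
  then have "M > 0"
    using x[of 0] by (meson order_less_le_trans zero_less_norm_iff)
  \<comment> \<open>A convex combination of the \<open>f n\<close> takes the value \<open>d\<close>
    at all late \<open>x k\<close>, and these have norm at most \<open>M\<close>.\<close>
  have lower: "d / M \<le> norm_on Y v" if v: "v \<in> convex hull range f" for v
  proof -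
    have "convex hull range f \<subseteq> {v. \<forall>\<^sub>F k in sequentially. blinfun_apply v (x k) = d}"
    proof (rule hull_minimal)
      show "range f \<subseteq> {v. \<forall>\<^sub>F k in sequentially. blinfun_apply v (x k) = d}"
        using fx(1) by (auto simp: eventually_sequentially)
      show "convex {v. \<forall>\<^sub>F k in sequentially. blinfun_apply v (x k) = d}"
        by (auto simp: convex_def blinfun.add_left blinfun.scaleR_left
            simp flip: distrib_right elim: eventually_elim2)
    qed
    then have "\<forall>\<^sub>F k in sequentially. v (x k) = d"
      using v by blast
    then obtain k where k: "v (x k) = d"
      by (auto simp: eventually_sequentially)
    have "x k \<in> Y"
      unfolding Y_def by (meson closure_subset rangeI span_superset subsetD)
    then have "(1 / M) *\<^sub>R x k \<in> Y"
      by (rule subspace_scale[OF Y(1)])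
    then have "v ((1 / M) *\<^sub>R x k) \<le> norm_on Y v"
      using x[of k] \<open>M > 0\<close> by (intro norm_on_upper) auto
    then show ?thesis
      using k by (simp add: blinfun.scaleR_right)
  qed
  have dM: "0 < d / M"
    using \<open>d > 0\<close> \<open>M > 0\<close> by simp
  obtain g T where g: "0 < norm_on Y g"
    and T: "\<And>n. norm_on Y (T n) \<le> norm_on Y g * (1 - (1/2)^n / 2)"
    and gT: "\<And>n. \<exists>v\<in>closure (convex hull (f ` {n..})). g = T n + (1/2)^n *\<^sub>R v"
    by (rule James_sequence[where f = f, OF sublinear_norm_on[OF \<open>0 \<in> Y\<close>]
          norm_on_le_norm[OF \<open>0 \<in> Y\<close>] f dM lower]) (assumption, rule that)
  have "g y < norm_on Y g" if y: "y \<in> Y" "norm y \<le> 1" for y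
  proof -
    have "\<forall>\<^sub>F n in sequentially. f n y < norm_on Y g / 4"
    proof (rule functionals_eventually_small_on_closure_span[where f = f and x = x, OF f fx(2)])
      show "y \<in> closure (span (range x))"
        using y(1) by (simp add: Y_def)
    qed (use g in auto)
    then obtain n where n: "\<And>k. k \<ge> n \<Longrightarrow> f k y < norm_on Y g / 4"
      by (auto simp: eventually_sequentially)
    obtain v where v: "v \<in> closure (convex hull (f ` {n..}))" "g = T n + (1/2)^n *\<^sub>R v"
      using gT by blast
    have "v y \<le> norm_on Y g / 4"
      using n by (intro blinfun_le_on_closure_convex_hull[OF v(1)]) (auto intro: less_imp_le)
    then have "(1/2)^n * v y \<le> (1/2)^n * (norm_on Y g / 4)"
      by (intro mult_left_mono) auto
    moreover have "T n y \<le> norm_on Y g * (1 - (1/2)^n / 2)"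
      using norm_on_upper[OF y] T order_trans by blast
    moreover have "norm_on Y g * (1 - (1/2)^n / 2) + (1/2)^n * (norm_on Y g / 4)
      = norm_on Y g - (1/2)^n * norm_on Y g / 4"
      by (simp add: algebra_simps)
    moreover have "0 < (1/2)^n * norm_on Y g"
      using g by simp
    moreover have "g y = T n y + (1/2)^n * v y"
      by (subst v(2)) (simp add: blinfun.add_left blinfun.scaleR_left)
    ultimately show ?thesis
      by linarith
  qed
  then show ?thesis
    using that Y g by blast
qed

text \<open>As \<open>V 0 y\<close> is the squared norm, \<open>u\<close> has minimal norm in the
  slice \<open>1 \<le> g y\<close> of \<open>Y\<close>. Any \<open>z\<close> in \<open>Y\<close>
  with \<open>g z > 0\<close> rescales into the slice, so \<open>norm u \<le> norm z / g z\<close>;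
  thus \<open>1 / norm u\<close> is the norm of \<open>g\<close> on \<open>Y\<close>, attained at
  the normalized \<open>u\<close>.\<close>

lemma generalized_projection_zero_imp_norm_attaining:
  fixes Y :: "'a::real_normed_vector set" and g :: "'a dual"
  assumes Y: "subspace Y" and pos: "0 < norm_on Y g"
    and u: "u \<in> generalized_projection {y \<in> Y. 1 \<le> g y} 0"
  shows "\<exists>y\<in>Y. norm y \<le> 1 \<and> g y = norm_on Y g"
proof -
  define C where "C = {y \<in> Y. 1 \<le> g y}"
  have uY: "u \<in> Y" "1 \<le> g u"
    using u by (auto simp: generalized_projection_def)
  then have "u \<noteq> 0"
    by auto
  have bdd: "bdd_below (V 0 ` C)"
    by (intro bdd_belowI2[where m = 0]) (simp add: V_def)
  have min: "norm u \<le> norm c" if "c \<in> C" for c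
  proof -
    have "V 0 u \<le> V 0 c"
      using u cINF_lower[OF bdd that] by (simp add: generalized_projection_def C_def)
    then show ?thesis
      by (simp add: V_def)
  qed
  define y where "y = (1 / norm u) *\<^sub>R u"
  have y: "y \<in> Y" "norm y \<le> 1"
    using uY \<open>u \<noteq> 0\<close> subspace_scale[OF Y] by (auto simp: y_def)
  have gy: "1 / norm u \<le> g y"
    using uY \<open>u \<noteq> 0\<close> by (simp add: y_def blinfun.scaleR_right divide_right_mono)
  have "norm_on Y g \<le> g y"
  proof (rule norm_on_least[OF subspace_0[OF Y]])
    fix z assume z: "z \<in> Y" "norm z \<le> 1"
    show "g z \<le> g y"
    proof (cases "g z > 0")
      case True
      then have "(1 / g z) *\<^sub>R z \<in> C"
        using subspace_scale[OF Y z(1)] by (simp add: C_def blinfun.scaleR_right)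
      then have "norm u \<le> norm z / g z"
        using min[of "(1 / g z) *\<^sub>R z"] True by simp
      then have "norm u * g z \<le> 1"
        using z(2) True by (simp add: field_simps)
      then have "g z \<le> 1 / norm u"
        using \<open>u \<noteq> 0\<close> by (simp add: field_simps)
      then show ?thesis
        using gy by linarith
    next
      case False
      then show ?thesis
        using gy by (meson linorder_not_less norm_ge_zero order_trans zero_le_divide_1_iff)
    qed
  qed
  then show ?thesis
    using y norm_on_upper[OF y, of g] by force
qed

lemma nonreflexive_empty_generalized_projection:
  assumes "\<not> reflexive_space TYPE('a::banach)"
  obtains C :: "'a::banach set" where "C \<noteq> {}" "closed C" "convex C"
    "generalized_projection C 0 = {}"
proof -
  obtain Y :: "'a set" and g :: "'a dual" where Y: "subspace Y" "closed Y"
    and pos: "0 < norm_on Y g"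
    and less: "\<And>y. y \<in> Y \<Longrightarrow> norm y \<le> 1 \<Longrightarrow> g y < norm_on Y g"
    by (rule nonreflexive_not_norm_attaining[OF assms]) (rule that)
  define C where "C = {y \<in> Y. 1 \<le> g y}"
  have C: "C = Y \<inter> {y. 1 \<le> g y}"
    by (auto simp: C_def)
  have "\<exists>y\<in>Y. g y > 0"
  proof (rule ccontr)
    assume "\<not> ?thesis"
    then have "norm_on Y g \<le> 0"
      by (intro norm_on_least subspace_0 Y) (auto simp: not_less)
    then show False
      using pos by simp
  qed
  then obtain y where "y \<in> Y" "g y > 0"
    by blast
  then have "(1 / g y) *\<^sub>R y \<in> C"
    using subspace_scale[OF Y(1)] by (simp add: C_def blinfun.scaleR_right)
  then have "C \<noteq> {}"
    by blast
  moreover have "closed C"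
    unfolding C by (intro closed_Int Y closed_Collect_le continuous_intros)
  moreover have "convex C"
    unfolding C
  proof (rule convex_Int[OF subspace_imp_convex[OF Y(1)]])
    have "{y. 1 \<le> g y} = g -` {1..}"
      by auto
    then show "convex {y. 1 \<le> g y}"
      using convex_linear_vimage[OF bounded_linear.linear[OF blinfun.bounded_linear_right], of "{1..}" g]
      by simp
  qed
  moreover have "generalized_projection C 0 = {}"
    using generalized_projection_zero_imp_norm_attaining[OF Y(1) pos] less
    unfolding C_def by fastforce
  ultimately show ?thesis
    using that by blast
qed

theorem theorem2p8:
  "reflexive_space TYPE('a::banach) \<longleftrightarrow>
    (\<forall>C :: 'a set. C \<noteq> {} \<and> closed C \<and> convex C \<longrightarrow>
      (\<forall>\<phi> :: 'a dual. generalized_projection C \<phi> \<noteq> {}))"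
  using reflexive_imp_generalized_projection nonreflexive_empty_generalized_projection
  by metis

end
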